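(* Let $n>m\ge 1$ and let $p_1,\dots,p_m\ge 1$ be integers with $\sum_{i=1}^m p_i=n$. Let $A\in\mathbb{R}^{m\times n}$ be an individual Volterra-Lyapunov stable matrix with respect to the configuration $(p_1,\dots,p_m)$. Then there exists a block diagonal matrix $K\in\mathbb{R}^{n\times m}$ of structure $(p_1,\dots,p_m)$ with non-negative entries such that for every diagonal matrix $E=\mathrm{diag}(\varepsilon_{1,1},\dots,\varepsilon_{1,p_1},\dots,\varepsilon_{m,1},\dots,\varepsilon_{m,p_m})\in\mathbb{R}^{n\times n}$ with all $\varepsilon_{i,l}\ge 0$, and for every non-empty index set $j\subseteq\{1,\dots,m\}$ such that for each $i\in j$ at least one of $\varepsilon_{i,1},\dots,\varepsilon_{i,p_i}$ is non-zero, every eigenvalue $\sigma$ of the principal submatrix $[AEK]_j$ satisfies $\mathrm{Re}(\sigma)>0$.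
   Context: The columns of $A\in\mathbb{R}^{m\times n}$ are indexed in order, according to the configuration $(p_1,\dots,p_m)$ with $\sum_{i=1}^m p_i=n$, as $A=[\boldsymbol{a}_{1,1},\dots,\boldsymbol{a}_{1,p_1},\boldsymbol{a}_{2,1},\dots,\boldsymbol{a}_{2,p_2},\dots,\boldsymbol{a}_{m,1},\dots,\boldsymbol{a}_{m,p_m}]$. A block diagonal matrix $K\in\mathbb{R}^{n\times m}$ of structure $(p_1,\dots,p_m)$ is a matrix whose rows are indexed by the same pairs $(i,l)$, $1\le i\le m$, $1\le l\le p_i$, in the same order, and whose row $(i,l)$ has the entry $k_{i,l}$ in column $i$ and zeros elsewhere. Thus the $i$-th column of $AEK$ is $\sum_{l=1}^{p_i}\varepsilon_{i,l}k_{i,l}\boldsymbol{a}_{i,l}$. The $m$-order squared matrices of $A$ (with respect to the configuration) are the $N=\prod_{i=1}^m p_i$ matrices in $\mathbb{R}^{m\times m}$ of the form $[\boldsymbol{a}_{1,\kappa_1},\boldsymbol{a}_{2,\kappa_2},\dots,\boldsymbol{a}_{m,\kappa_m}]$ with $\kappa_i\in\{1,\dots,p_i\}$ (one column selected from each group). $A$ is called an individual Volterra-Lyapunov stable matrix if for each $m$-order squared matrix $S$ of $A$ there exists a diagonal matrix $D_S\in\mathbb{R}^{m\times m}$ with positive diagonal entries (which may depend on $S$) such that $SD_S+D_SS^T$ is positive definite. For $M\in\mathbb{R}^{m\times m}$ and a non-empty $j\subseteq\{1,\dots,m\}$, $[M]_j$ denotes the principal submatrix of $M$ with rows and columns indexed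 by $j$. *)

theory Defs
  imports
    Complex_Main
    "Jordan_Normal_Form.Char_Poly"
    "Jordan_Normal_Form.DL_Submatrix"
begin

(* A configuration is given by m and p :: nat => nat, of which only the values p i for
   i < m matter. Groups i < m and positions l < p i within a group are counted from 0,
   so the pair (i, l) here is the pair (i + 1, l + 1) of the usual 1-based notation. *)

definition grp_idx :: "(nat \<Rightarrow> nat) \<Rightarrow> nat \<Rightarrow> nat \<Rightarrow> nat" where
  "grp_idx p i l = (\<Sum>i'<i. p i') + l"

definition block_diagonal :: "nat \<Rightarrow> (nat \<Rightarrow> nat) \<Rightarrow> real mat \<Rightarrow> bool" where
  "block_diagonal m p K \<longleftrightarrow>
     K \<in> carrier_mat (\<Sum>i<m. p i) m \<and>
     (\<forall>i<m. \<forall>l<p i. \<forall>c<m. c \<noteq> i \<longrightarrow> K $$ (grp_idx p i l, c) = 0)"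

definition squared_matrices :: "nat \<Rightarrow> (nat \<Rightarrow> nat) \<Rightarrow> real mat \<Rightarrow> real mat set" where
  "squared_matrices m p A =
     {mat_of_cols m (map (\<lambda>i. col A (grp_idx p i (\<kappa> i))) [0..<m]) | \<kappa>. \<forall>i<m. \<kappa> i < p i}"

definition positive_definite :: "real mat \<Rightarrow> bool" where
  "positive_definite M \<longleftrightarrow>
     square_mat M \<and> transpose_mat M = M \<and>
     (\<forall>v \<in> carrier_vec (dim_row M). v \<noteq> 0\<^sub>v (dim_row M) \<longrightarrow> v \<bullet> (M *\<^sub>v v) > 0)"

definition individual_Volterra_Lyapunov_stable ::
    "nat \<Rightarrow> (nat \<Rightarrow> nat) \<Rightarrow> real mat \<Rightarrow> bool" where
  "individual_Volterra_Lyapunov_stable m p A \<longleftrightarrow>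
     (\<forall>S \<in> squared_matrices m p A.
        \<exists>D \<in> carrier_mat m m. diagonal_mat D \<and> (\<forall>i<m. D $$ (i, i) > 0) \<and>
          positive_definite (S * D + D * transpose_mat S))"

end

theory Submission
  imports Defs
begin

text \<open>
  Take all block entries of \<open>K\<close> equal to 1. If \<open>\<sigma>\<close> is an eigenvalue of \<open>[AEK]\<^sub>J\<close> with
  \<open>Re \<sigma> \<le> 0\<close>, let \<open>y\<^sup>*\<close> be a left eigenvector, extended by zero outside \<open>J\<close>. Multiplying the
  \<open>i\<close>-th eigenvector equation by \<open>y\<^sub>i\<close> shows that a non-negative combination, over \<open>l\<close>, of the
  numbers \<open>Re (y\<^sub>i y\<^sup>* a\<^sub>i\<^sub>l)\<close> is \<open>Re \<sigma> \<bar>y\<^sub>i\<bar>\<^sup>2 \<le> 0\<close>, so for each \<open>i\<close> one column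
  \<open>\<kappa>\<^sub>i\<close> makes this number non-positive. For the squared matrix \<open>S\<close> selected by \<open>\<kappa>\<close> this
  contradicts \<open>0 < Re (y\<^sup>* S D y)\<close>.
\<close>

section \<open>Sums over grouped column indices and the 0-1 block diagonal matrix\<close>

lemma sum_lessThan_add:
  fixes f :: "nat \<Rightarrow> 'a::comm_monoid_add"
  shows "(\<Sum>k<a + b. f k) = (\<Sum>k<a. f k) + (\<Sum>l<b. f (a + l))"
  by (induction b) (simp_all add: add.assoc)

lemma sum_grp_idx:
  fixes f :: "nat \<Rightarrow> 'a::comm_monoid_add"
  shows "(\<Sum>k<(\<Sum>i<m. p i). f k) = (\<Sum>i<m. \<Sum>l<p i. f (grp_idx p i l))"
  by (induction m) (simp_all add: sum_lessThan_add grp_idx_def)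

lemma grp_idx_less:
  assumes "i < m" "l < p i"
  shows "grp_idx p i l < (\<Sum>i<m. p i)"
proof -
  have "(\<Sum>j<Suc i. p j) \<le> (\<Sum>i<m. p i)"
    using assms by (intro sum_mono2) auto
  then show ?thesis using assms by (simp add: grp_idx_def)
qed

text \<open>The witness for \<open>K\<close>, with every block entry equal to 1. Whether row
  \<open>r\<close> lies in group \<open>c\<close> is tested against the partial sums of
  \<open>p\<close>, so \<open>grp_idx\<close> need not be inverted.\<close>

definition group_indicator_mat :: "nat \<Rightarrow> (nat \<Rightarrow> nat) \<Rightarrow> real mat" where
  "group_indicator_mat m p = mat (\<Sum>i<m. p i) m
     (\<lambda>(r, c). of_bool ((\<Sum>i<c. p i) \<le> r \<and> r < (\<Sum>i<Suc c. p i)))"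

lemma group_indicator_mat_carrier:
  "group_indicator_mat m p \<in> carrier_mat (\<Sum>i<m. p i) m"
  by (simp add: group_indicator_mat_def)

lemma group_indicator_mat_grp_idx:
  assumes "i < m" "l < p i" "c < m"
  shows "group_indicator_mat m p $$ (grp_idx p i l, c) = of_bool (i = c)"
proof -
  have mono: "(\<Sum>i<a. p i) \<le> (\<Sum>i<b. p i)" if "a \<le> b" for a b
    using that by (intro sum_mono2) auto
  have "((\<Sum>i<c. p i) \<le> grp_idx p i l \<and> grp_idx p i l < (\<Sum>i<Suc c. p i)) = (i = c)"
    \<comment> \<open>For \<open>i < c\<close>, group \<open>i\<close> ends before group
      \<open>c\<close> starts; for \<open>c < i\<close>, it starts only after group \<open>c\<close>
      has ended.\<close>
    using mono[of "Suc i" c] mono[of "Suc c" i] \<open>l < p i\<close>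
    by (cases i c rule: linorder_cases) (auto simp: grp_idx_def)
  then show ?thesis
    using assms grp_idx_less[of i m l p] by (simp add: group_indicator_mat_def)
qed

lemma mult_diagonal_mat_index:
  fixes E :: "'a::semiring_0 mat"
  assumes "A \<in> carrier_mat k n" "E \<in> carrier_mat n n" "diagonal_mat E" "r < k" "c < n"
  shows "(A * E) $$ (r, c) = A $$ (r, c) * E $$ (c, c)"
proof -
  have "(A * E) $$ (r, c) = (\<Sum>s<n. A $$ (r, s) * E $$ (s, c))"
    using assms by (simp add: scalar_prod_def atLeast0LessThan)
  also have "\<dots> = (\<Sum>s<n. if s = c then A $$ (r, c) * E $$ (c, c) else 0)"
    using assms by (intro sum.cong) (auto simp: diagonal_mat_def)
  finally show ?thesis using assms by simp
qed

text \<open>Once the sum over \<open>s\<close> is split by groups, only group \<open>c\<close>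
  survives. Multiplying by the indicator matrix thus adds up the rescaled columns of
  \<open>A\<close> within each group.\<close>

lemma mult_group_indicator_mat_index:
  assumes "A \<in> carrier_mat k (\<Sum>i<m. p i)" "E \<in> carrier_mat (\<Sum>i<m. p i) (\<Sum>i<m. p i)"
    "diagonal_mat E" "r < k" "c < m"
  shows "(A * E * group_indicator_mat m p) $$ (r, c) =
    (\<Sum>l<p c. A $$ (r, grp_idx p c l) * E $$ (grp_idx p c l, grp_idx p c l))"
proof -
  let ?n = "\<Sum>i<m. p i" and ?K = "group_indicator_mat m p"
  have "(A * E * ?K) $$ (r, c) = (\<Sum>s<?n. (A * E) $$ (r, s) * ?K $$ (s, c))"
    using assms group_indicator_mat_carrier[of m p]
    by (subst index_mult_mat) (auto simp: scalar_prod_def atLeast0LessThan intro!: sum.cong)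
  also have "\<dots> = (\<Sum>i<m. \<Sum>l<p i. (A * E) $$ (r, grp_idx p i l) * ?K $$ (grp_idx p i l, c))"
    by (rule sum_grp_idx)
  also have "\<dots> = (\<Sum>i<m. if i = c then (\<Sum>l<p c. (A * E) $$ (r, grp_idx p c l)) else 0)"
    using assms by (intro sum.cong) (auto simp: group_indicator_mat_grp_idx)
  also have "\<dots> = (\<Sum>l<p c. (A * E) $$ (r, grp_idx p c l))"
    using assms by simp
  also have "\<dots> = (\<Sum>l<p c. A $$ (r, grp_idx p c l) * E $$ (grp_idx p c l, grp_idx p c l))"
    using assms grp_idx_less[of c m _ p]
    by (intro sum.cong) (auto simp: mult_diagonal_mat_index[where k = k and n = ?n] simp del: index_mult_mat(1))
  finally show ?thesis .
qed

section \<open>Left eigenvectors of principal submatrices\<close>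

lemma bij_betw_pick:
  assumes "finite J"
  shows "bij_betw (pick J) {..<card J} J"
proof -
  have "inj_on (pick J) {..<card J}"
    by (rule linorder_inj_onI) (auto dest: pick_mono_le[of _ J])
  moreover have "pick J ` {..<card J} \<subseteq> J"
    by (auto intro: pick_in_set_le)
  ultimately show ?thesis
    using assms by (simp add: bij_betw_def card_image card_subset_eq)
qed

text \<open>A matrix and its transpose share their characteristic polynomial, so \<sigma> has an
  eigenvector for the transpose; this is its equation, without conjugation.\<close>

lemma eigenvalue_left_eigenvector:
  fixes M :: "'a::field mat"
  assumes M: "M \<in> carrier_mat k k" and "eigenvalue M \<sigma>"
  obtains w where "w \<in> carrier_vec k" "w \<noteq> 0\<^sub>v k"
    "\<And>c. c < k \<Longrightarrow> (\<Sum>r<k. w $ r * M $$ (r, c)) = \<sigma> * w $ c"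
proof -
  have "eigenvalue (transpose_mat M) \<sigma>"
    using assms by (metis char_poly_transpose_mat eigenvalue_root_char_poly transpose_carrier_mat)
  then obtain w where w: "w \<in> carrier_vec k" "w \<noteq> 0\<^sub>v k" "transpose_mat M *\<^sub>v w = \<sigma> \<cdot>\<^sub>v w"
    using M by (auto simp: eigenvalue_def eigenvector_def)
  have "(\<Sum>r<k. w $ r * M $$ (r, c)) = \<sigma> * w $ c" if "c < k" for c
  proof -
    have "(\<Sum>r<k. w $ r * M $$ (r, c)) = (transpose_mat M *\<^sub>v w) $ c"
      using M w(1) that by (simp add: scalar_prod_def atLeast0LessThan mult.commute)
    then show ?thesis using w that by simp
  qed
  with w that show thesis by blast
qed

text \<open>Extending a left eigenvector by zero outside \<open>J\<close> allows sums over all rows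
  of \<open>M\<close>. The eigenvector equation is claimed only for columns in
  \<open>J\<close>.\<close>

lemma submatrix_left_eigenvector:
  assumes M: "M \<in> carrier_mat m m" and J: "J \<subseteq> {..<m}"
    and ev: "eigenvalue (map_mat complex_of_real (submatrix M J J)) \<sigma>"
  obtains z where "\<And>i. i \<notin> J \<Longrightarrow> z i = 0" "\<exists>i\<in>J. z i \<noteq> 0"
    "\<And>i. i \<in> J \<Longrightarrow> (\<Sum>r<m. z r * complex_of_real (M $$ (r, i))) = \<sigma> * z i"
proof -
  have fin: "finite J" using J finite_subset by blast
  note bij = bij_betw_pick[OF fin]
  have JM: "{i. i < m \<and> i \<in> J} = J" using J by auto
  have sub: "submatrix M J J \<in> carrier_mat (card J) (card J)"
    using M by (intro carrier_matI) (simp_all add: dim_submatrix JM)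
  obtain w where w: "w \<in> carrier_vec (card J)" "w \<noteq> 0\<^sub>v (card J)"
    "\<And>c. c < card J \<Longrightarrow>
      (\<Sum>r<card J. w $ r * map_mat complex_of_real (submatrix M J J) $$ (r, c)) = \<sigma> * w $ c"
    using sub by (elim eigenvalue_left_eigenvector[OF _ ev, rotated]) auto
  \<comment> \<open>\<open>pick J\<close> sends positions in the submatrix to elements of
    \<open>J\<close>; its inverse carries the entries of \<open>w\<close> back to the original
    indices.\<close>
  define z where "z i = (if i \<in> J then w $ inv_into {..<card J} (pick J) i else 0)" for i
  have z_pick: "z (pick J a) = w $ a" if "a < card J" for a
    using bij that by (simp add: z_def pick_in_set_le bij_betw_def)
  show thesis
  proof
    show "z i = 0" if "i \<notin> J" for i using that by (simp add: z_def)
    obtain a where "a < card J" "w $ a \<noteq> 0"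
      using w(1,2) by (metis carrier_vecD eq_vecI index_zero_vec)
    then show "\<exists>i\<in>J. z i \<noteq> 0" using z_pick pick_in_set_le by metis
    show "(\<Sum>r<m. z r * complex_of_real (M $$ (r, i))) = \<sigma> * z i" if "i \<in> J" for i
    proof -
      obtain c where c: "c < card J" "i = pick J c"
        using bij \<open>i \<in> J\<close> by (auto simp: bij_betw_def)
      have "(\<Sum>r<m. z r * complex_of_real (M $$ (r, i))) =
          (\<Sum>r\<in>J. z r * complex_of_real (M $$ (r, i)))"
        using J by (intro sum.mono_neutral_right) (auto simp: z_def)
      also have "\<dots> = (\<Sum>r<card J. z (pick J r) * complex_of_real (M $$ (pick J r, i)))"
        using bij by (rule sum.reindex_bij_betw[symmetric])
      also have "\<dots> = (\<Sum>r<card J. w $ r * map_mat complex_of_real (submatrix M J J) $$ (r, c))"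
        using c M sub by (intro sum.cong) (auto simp: z_pick submatrix_index JM)
      also have "\<dots> = \<sigma> * z i" using w(3) c z_pick by simp
      finally show ?thesis .
    qed
  qed
qed

section \<open>The quadratic form of the Lyapunov matrix\<close>

lemma scalar_prod_mult_mat_vec:
  fixes M :: "'a::comm_semiring_0 mat"
  assumes "M \<in> carrier_mat k n" "u \<in> carrier_vec k" "v \<in> carrier_vec n"
  shows "u \<bullet> (M *\<^sub>v v) = (\<Sum>r<k. \<Sum>i<n. u $ r * (M $$ (r, i) * v $ i))"
  using assms by (simp add: scalar_prod_def atLeast0LessThan sum_distrib_left)

text \<open>As \<open>D\<close> is symmetric, the second summand is the transpose of
  \<open>S * D\<close> and has the same quadratic form, whence the factor 2. Since \<open>D\<close>
  scales the columns of \<open>S\<close>, the form splits into one term per column.\<close>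

lemma scalar_prod_Lyapunov:
  fixes S D :: "real mat"
  assumes S: "S \<in> carrier_mat m m" and D: "D \<in> carrier_mat m m" "diagonal_mat D"
    and u: "u \<in> carrier_vec m"
  shows "u \<bullet> ((S * D + D * transpose_mat S) *\<^sub>v u) =
    2 * (\<Sum>i<m. D $$ (i, i) * (u $ i * (\<Sum>r<m. u $ r * S $$ (r, i))))"
proof -
  have DT: "transpose_mat D = D"
    using D by (intro eq_matI) (auto simp: diagonal_mat_def, metis)
  have SD: "S * D \<in> carrier_mat m m" using S D by simp
  have T: "D * transpose_mat S = transpose_mat (S * D)"
    using S D by (simp add: transpose_mult DT)
  have "u \<bullet> (transpose_mat (S * D) *\<^sub>v u) = u \<bullet> ((S * D) *\<^sub>v u)"
    using SD u transpose_vec_mult_scalar[OF SD u u]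
    by (metis comm_scalar_prod mult_mat_vec_carrier transpose_carrier_mat)
  moreover have "u \<bullet> ((S * D) *\<^sub>v u) =
      (\<Sum>r<m. \<Sum>i<m. u $ r * (S $$ (r, i) * D $$ (i, i) * u $ i))"
    by (simp add: scalar_prod_mult_mat_vec[OF SD u u] mult_diagonal_mat_index[OF S D]
        del: index_mult_mat(1))
  moreover have "\<dots> = (\<Sum>i<m. D $$ (i, i) * (u $ i * (\<Sum>r<m. u $ r * S $$ (r, i))))"
    by (subst sum.swap) (simp add: sum_distrib_left algebra_simps)
  ultimately show ?thesis
    using SD u T by (simp add: add_mult_distrib_mat_vec scalar_prod_add_distrib)
qed

text \<open>The form stays positive on complex vectors; being a sum over columns with positive
  weights \<open>D $$ (i, i)\<close>, it has a positive term.\<close>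

lemma Volterra_Lyapunov_column_positive:
  fixes S D :: "real mat" and z :: "nat \<Rightarrow> complex"
  assumes S: "S \<in> carrier_mat m m" and D: "D \<in> carrier_mat m m" "diagonal_mat D"
    and Dpos: "\<And>i. i < m \<Longrightarrow> 0 < D $$ (i, i)"
    and pd: "positive_definite (S * D + D * transpose_mat S)"
    and z: "\<exists>i<m. z i \<noteq> 0"
  obtains i where "i < m" "0 < Re (cnj (z i) * (\<Sum>r<m. z r * complex_of_real (S $$ (r, i))))"
proof -
  define q where "q u = (\<Sum>i<m. D $$ (i, i) * (u i * (\<Sum>r<m. u r * S $$ (r, i))))"
    for u :: "nat \<Rightarrow> real"
  have q: "2 * q u = vec m u \<bullet> ((S * D + D * transpose_mat S) *\<^sub>v vec m u)" for u
    using scalar_prod_Lyapunov[OF S D, of "vec m u"] by (simp add: q_def)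
  have q_pos: "0 < q u" if "\<exists>i<m. u i \<noteq> 0" for u
  proof -
    have "vec m u \<noteq> 0\<^sub>v m" using that by (metis index_vec index_zero_vec(1))
    then have "0 < 2 * q u" using pd S D by (auto simp: positive_definite_def q)
    then show ?thesis by simp
  qed
  have q_nonneg: "0 \<le> q u" for u
  proof (cases "\<exists>i<m. u i \<noteq> 0")
    case False
    then show ?thesis by (simp add: q_def)
  qed (use q_pos less_imp_le in blast)
  \<comment> \<open>\<open>S\<close> and \<open>D\<close> are real, so products of a real with an
    imaginary part enter only the imaginary part of the form.\<close>
  have "(\<Sum>i<m. D $$ (i, i) * Re (cnj (z i) * (\<Sum>r<m. z r * complex_of_real (S $$ (r, i))))) =
      q (\<lambda>i. Re (z i)) + q (\<lambda>i. Im (z i))"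
    by (simp add: q_def sum.distrib[symmetric] algebra_simps)
  moreover have "0 < q (\<lambda>i. Re (z i)) + q (\<lambda>i. Im (z i))"
  proof -
    have "(\<exists>i<m. Re (z i) \<noteq> 0) \<or> (\<exists>i<m. Im (z i) \<noteq> 0)"
      using z by (auto simp: complex_eq_iff)
    then show ?thesis
      using q_pos q_nonneg by (meson add_nonneg_pos add_pos_nonneg)
  qed
  ultimately have "\<exists>i<m. 0 <
      D $$ (i, i) * Re (cnj (z i) * (\<Sum>r<m. z r * complex_of_real (S $$ (r, i))))"
    by (metis (no_types, lifting) lessThan_iff not_less sum_nonpos)
  then show thesis
    using that Dpos by (meson zero_less_mult_pos)
qed

section \<open>Positivity of the real parts of the eigenvalues\<close>

lemma individual_VL_stable_eigenvalue_pos: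
  fixes A E :: "real mat"
  assumes A: "A \<in> carrier_mat m (\<Sum>i<m. p i)"
    and p: "\<forall>i<m. 1 \<le> p i"
    and VL: "individual_Volterra_Lyapunov_stable m p A"
    and E: "E \<in> carrier_mat (\<Sum>i<m. p i) (\<Sum>i<m. p i)" "diagonal_mat E"
    and E_nonneg: "\<forall>i<m. \<forall>l<p i. 0 \<le> E $$ (grp_idx p i l, grp_idx p i l)"
    and J: "J \<subseteq> {..<m}"
    and E_nz: "\<forall>i\<in>J. \<exists>l<p i. E $$ (grp_idx p i l, grp_idx p i l) \<noteq> 0"
    and ev: "eigenvalue (map_mat complex_of_real
      (submatrix (A * E * group_indicator_mat m p) J J)) \<sigma>"
  shows "Re \<sigma> > 0"
proof (rule ccontr)
  assume neg: "\<not> Re \<sigma> > 0"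
  let ?M = "A * E * group_indicator_mat m p"
  let ?e = "\<lambda>i l. E $$ (grp_idx p i l, grp_idx p i l)"
  have "?M \<in> carrier_mat m m"
    using A E group_indicator_mat_carrier[of m p] by (metis mult_carrier_mat)
  then obtain z where z: "\<And>i. i \<notin> J \<Longrightarrow> z i = 0" "\<exists>i\<in>J. z i \<noteq> 0"
    "\<And>i. i \<in> J \<Longrightarrow> (\<Sum>r<m. z r * complex_of_real (?M $$ (r, i))) = \<sigma> * z i"
    using submatrix_left_eigenvector[OF _ J ev] by blast
  \<comment> \<open>\<open>z\<close> is the row vector \<open>y\<^sup>*\<close>, so
    \<open>cnj (z i)\<close> is \<open>y\<^sub>i\<close>.\<close>
  define g where
    "g i l = Re (cnj (z i) * (\<Sum>r<m. z r * complex_of_real (A $$ (r, grp_idx p i l))))" for i l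
  have sum_g: "(\<Sum>l<p i. ?e i l * g i l) = Re \<sigma> * (cmod (z i))\<^sup>2" if i: "i \<in> J" for i
  proof -
    have "i < m" using i J by auto
    have "(\<Sum>l<p i. ?e i l * g i l) = Re (cnj (z i) * (\<Sum>l<p i. \<Sum>r<m.
        z r * complex_of_real (A $$ (r, grp_idx p i l) * ?e i l)))"
      by (simp add: g_def sum_distrib_left algebra_simps)
    also have "(\<Sum>l<p i. \<Sum>r<m. z r * complex_of_real (A $$ (r, grp_idx p i l) * ?e i l)) =
        (\<Sum>r<m. z r * complex_of_real (?M $$ (r, i)))"
      using mult_group_indicator_mat_index[OF A E _ \<open>i < m\<close>]
      by (subst sum.swap) (simp add: sum_distrib_left)
    also have "\<dots> = \<sigma> * z i" by (rule z(3)[OF i])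
    also have "cnj (z i) * (\<sigma> * z i) = \<sigma> * complex_of_real ((cmod (z i))\<^sup>2)"
      by (subst complex_norm_square) (simp add: mult_ac)
    finally show ?thesis by simp
  qed
  have "\<exists>l<p i. g i l \<le> 0" if i: "i < m" for i
  proof (cases "i \<in> J")
    case True
    show ?thesis
    proof (rule ccontr)
      assume "\<not> (\<exists>l<p i. g i l \<le> 0)"
      then have pos: "\<forall>l<p i. 0 < g i l" by auto
      \<comment> \<open>The weights are non-negative and this one is positive, so positive values
        \<open>g i l\<close> would make the weighted sum positive.\<close>
      obtain l where "l < p i" "?e i l \<noteq> 0" using E_nz True by blast
      then have "0 < (\<Sum>l<p i. ?e i l * g i l)"
        using E_nonneg i pos by (intro sum_pos2[of _ l]) (auto simp: less_le)
      moreover have "(\<Sum>l<p i. ?e i l * g i l) \<le> 0"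
        using neg by (simp add: sum_g[OF True] mult_nonpos_nonneg)
      ultimately show False by simp
    qed
  next
    case False
    \<comment> \<open>Here \<open>z i = 0\<close> makes every \<open>g i l\<close> vanish, so any
      column serves; position 0 exists because \<open>1 \<le> p i\<close>.\<close>
    then show ?thesis using p i by (auto simp: g_def z(1) intro!: exI[of _ 0])
  qed
  \<comment> \<open>The selection depends on \<open>z\<close>, hence on \<open>E\<close>,
    \<open>J\<close> and \<sigma>. This is harmless: \<open>K\<close> is fixed in advance, and
    stability provides a \<open>D\<close> for every selection.\<close>
  then obtain \<kappa> where \<kappa>: "\<And>i. i < m \<Longrightarrow> \<kappa> i < p i" "\<And>i. i < m \<Longrightarrow> g i (\<kappa> i) \<le> 0"
    by metis
  define S where "S = mat_of_cols m (map (\<lambda>i. col A (grp_idx p i (\<kappa> i))) [0..<m])"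
  have S: "S \<in> carrier_mat m m" by (intro carrier_matI) (simp_all add: S_def)
  have S_idx: "S $$ (r, i) = A $$ (r, grp_idx p i (\<kappa> i))" if "r < m" "i < m" for r i
    using that A \<kappa>(1) grp_idx_less[of i m "\<kappa> i" p] by (simp add: S_def mat_of_cols_index)
  have "S \<in> squared_matrices m p A"
    using \<kappa>(1) by (auto simp: squared_matrices_def S_def)
  then obtain D where D: "D \<in> carrier_mat m m" "diagonal_mat D" "\<And>i. i < m \<Longrightarrow> 0 < D $$ (i, i)"
    "positive_definite (S * D + D * transpose_mat S)"
    using VL unfolding individual_Volterra_Lyapunov_stable_def by blast
  have "\<exists>i<m. z i \<noteq> 0" using z(2) J by auto
  then obtain i where "i < m" "0 < Re (cnj (z i) * (\<Sum>r<m. z r * complex_of_real (S $$ (r, i))))"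
    using Volterra_Lyapunov_column_positive[OF S D] by blast
  then have "0 < g i (\<kappa> i)" by (simp add: g_def S_idx)
  then show False using \<kappa>(2)[OF \<open>i < m\<close>] by simp
qed

theorem theorem1:
  fixes m n :: nat and p :: "nat \<Rightarrow> nat" and A :: "real mat"
  assumes "1 \<le> m" and "m < n"
    and "\<forall>i<m. 1 \<le> p i" and "(\<Sum>i<m. p i) = n"
    and "A \<in> carrier_mat m n"
    and "individual_Volterra_Lyapunov_stable m p A"
  shows "\<exists>K. K \<in> carrier_mat n m \<and> block_diagonal m p K \<and>
           (\<forall>r<n. \<forall>c<m. 0 \<le> K $$ (r, c)) \<and>
           (\<forall>E J \<sigma>. E \<in> carrier_mat n n \<longrightarrow> diagonal_mat E \<longrightarrow>
              (\<forall>i<m. \<forall>l<p i. 0 \<le> E $$ (grp_idx p i l, grp_idx p i l)) \<longrightarrow>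
              J \<noteq> {} \<longrightarrow> J \<subseteq> {..<m} \<longrightarrow>
              (\<forall>i\<in>J. \<exists>l<p i. E $$ (grp_idx p i l, grp_idx p i l) \<noteq> 0) \<longrightarrow>
              eigenvalue (map_mat complex_of_real (submatrix (A * E * K) J J)) \<sigma> \<longrightarrow>
              Re \<sigma> > 0)"
proof (intro exI[of _ "group_indicator_mat m p"] conjI)
  show "group_indicator_mat m p \<in> carrier_mat n m"
    using group_indicator_mat_carrier assms(4) by metis
  then show "block_diagonal m p (group_indicator_mat m p)"
    using assms(4) by (auto simp: block_diagonal_def group_indicator_mat_grp_idx)
  show "\<forall>r<n. \<forall>c<m. 0 \<le> group_indicator_mat m p $$ (r, c)"
    using assms(4) by (auto simp: group_indicator_mat_def)
qed (use individual_VL_stable_eigenvalue_pos[of A m p] assms(3-6) in blast)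

end
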